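(* Consider a two-player zero-sum game $G=(S,T,u)$ where $S=\{x\in C:\langle\alpha,x\rangle\in H\}\subseteq X$ and $T=\{y\in K:\langle y,\beta\rangle\in Q\}\subseteq Y$ are cone-leveled sets, normalized so that $H\subseteq[\gamma,1]$ with $\gamma,1\in H$ for some $\gamma\in(0,1]$ and $Q\subseteq[1,\delta]$ with $1,\delta\in Q$ for some $\delta\ge 1$; where $u(x,y)=\langle y,Ax\rangle$ for a linear operator $A:X\to Z$; and where the lower value $\underline v$ and the upper value $\overline v$ are finite. Assume that $\underline v>0$. Consider the primal-dual pair of conic programs $$(P_\beta):\ \inf_x\ \langle\alpha,x\rangle\ \text{ s.t. } Ax-\beta\in K^*,\ x\in C;\qquad (D_\alpha):\ \sup_y\ \langle y,\beta\rangle\ \text{ s.t. } -A^*y+\alpha\in C^*,\ y\in K.$$ If both $(P_\beta)$ and $(D_\alpha)$ are feasible and $\mathrm{val}(P_\beta)=\mathrm{val}(D_\alpha)>0$, then $\underline v=\overline v$ and the game value $v:=\underline v=\overline v$ satisfies $v=\frac{1}{\mathrm{val}(P_\beta)}$. Moreover, if $x^*$ is an optimal solution for $(P_\beta)$ and $y^*$ is an optimal solution for $(D_\alpha)$, then $(vx^*,vy^* )$ is a saddle point of $G$.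
   Context: $(X,W)$ and $(Z,Y)$ are dual pairs of real locally convex topological vector spaces, with bilinear forms $\langle\cdot,\cdot\rangle:W\times X\to\mathbb R$ and $\langle\cdot,\cdot\rangle:Y\times Z\to\mathbb R$, each space separating the points of its partner. The linear operator $A:X\to Z$ is assumed to have an adjoint: for every $y\in Y$ there is a unique $A^*y\in W$ with $\langle A^*y,x\rangle=\langle y,Ax\rangle$ for all $x\in X$, and $A^*:Y\to W$ is linear. A set $C$ is a convex cone if $\lambda C\subseteq C$ for all $\lambda\ge0$ and $\kappa C+(1-\kappa)C\subseteq C$ for all $\kappa\in[0,1]$. For convex cones $C\subseteq X$, $K\subseteq Y$: $C^*=\{w\in W:\langle w,x\rangle\ge0\ \forall x\in C\}$ and $K^*=\{z\in Z:\langle y,z\rangle\ge0\ \forall y\in K\}$. A set $S\subseteq X$ is cone-leveled if there exist $\alpha\in W\setminus\{0\}$, a convex cone $C\subseteq X$ and a non-empty $H\subseteq[p,q]$ with $p,q\in H$, $0<p\le q$ real, such that $S=\{x\in C:\langle\alpha,x\rangle\in H\}$ and such that $\{x\in C:\langle\alpha,x\rangle=r\}$ is non-empty for $r=p,q$. Cone-leveled subsets $T\subseteq Y$ are defined analogously, with a convex cone $K\subseteq Y$, $\beta\in Z\setminus\{0\}$ and $Q\subseteq[p',q']$. Player I chooses $x\in S$ and maximizes $u$; player II chooses $y\in T$ and minimizes $u$. $\underline v=\sup_{x\in S}\inf_{y\in T}u(x,y)$ and $\overline v=\inf_{y\in T}\sup_{x\in S}u(x,y)$. A saddle point (Nash equilibrium)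 is $(x^*,y^* )\in S\times T$ with $u(x^*,y)\ge u(x^*,y^* )\ge u(x,y^* )$ for all $x\in S$, $y\in T$. A program is feasible if its feasible set is non-empty; $\mathrm{val}$ denotes its optimal value (the infimum, resp. supremum, of the objective over the feasible set); an optimal solution is a feasible point at which the optimal value is attained. *)

theory Defs
  imports "HOL-Analysis.Analysis"
begin

(* The four spaces are types of class real_vector; each carries an explicit abstract topology, since
   the library has no type class for topological vector spaces.  No relation between the topologies
   and the pairings is imposed beyond the separation of points. *)

definition locally_convex_tvs :: "'a::real_vector topology \<Rightarrow> bool" where
  "locally_convex_tvs \<tau> \<longleftrightarrow>
     topspace \<tau> = UNIV \<and>
     continuous_map (prod_topology \<tau> \<tau>) \<tau> (\<lambda>(x, y). x + y) \<and>
     continuous_map (prod_topology euclideanreal \<tau>) \<tau> (\<lambda>(c, x). c *\<^sub>R x) \<and>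
     (\<forall>U. openin \<tau> U \<and> 0 \<in> U \<longrightarrow> (\<exists>V. openin \<tau> V \<and> 0 \<in> V \<and> convex V \<and> V \<subseteq> U))"

definition dual_pair :: "('w::real_vector \<Rightarrow> 'x::real_vector \<Rightarrow> real) \<Rightarrow> bool" where
  "dual_pair p \<longleftrightarrow>
     bilinear p \<and>
     (\<forall>x. x \<noteq> 0 \<longrightarrow> (\<exists>w. p w x \<noteq> 0)) \<and>
     (\<forall>w. w \<noteq> 0 \<longrightarrow> (\<exists>x. p w x \<noteq> 0))"

(* The direction from left to right of the inner equivalence is the uniqueness of the adjoint. *)

definition is_adjoint ::
  "('w::real_vector \<Rightarrow> 'x::real_vector \<Rightarrow> real) \<Rightarrow> ('y::real_vector \<Rightarrow> 'z::real_vector \<Rightarrow> real) \<Rightarrow>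
   ('x \<Rightarrow> 'z) \<Rightarrow> ('y \<Rightarrow> 'w) \<Rightarrow> bool" where
  "is_adjoint pX pY A A' \<longleftrightarrow>
     linear A' \<and> (\<forall>y w. (\<forall>x. pX w x = pY y (A x)) \<longleftrightarrow> w = A' y)"

(* Not the library's convex_cone, which also demands that the set be non-empty. *)

definition is_convex_cone :: "'a::real_vector set \<Rightarrow> bool" where
  "is_convex_cone C \<longleftrightarrow> cone C \<and> convex C"

(* In the next three definitions the set lives in the second argument of the pairing.  For subsets
   of the first space of a pair they are used with the flipped pairing. *)

definition dual_cone :: "('w \<Rightarrow> 'x \<Rightarrow> real) \<Rightarrow> 'x set \<Rightarrow> 'w set" where
  "dual_cone p C = {w. \<forall>x\<in>C. p w x \<ge> 0}"

definition level_set :: "('w \<Rightarrow> 'x \<Rightarrow> real) \<Rightarrow> 'w \<Rightarrow> 'x set \<Rightarrow> real set \<Rightarrow> 'x set" where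
  "level_set p \<alpha> C H = {x \<in> C. p \<alpha> x \<in> H}"

(* The data \<alpha>, C, H and the end points a, b of the level interval exhibit level_set p \<alpha> C H as a
   cone-leveled set. *)

definition cone_leveled_by ::
  "('w::real_vector \<Rightarrow> 'x::real_vector \<Rightarrow> real) \<Rightarrow> 'w \<Rightarrow> 'x set \<Rightarrow> real set \<Rightarrow> real \<Rightarrow> real \<Rightarrow> bool" where
  "cone_leveled_by p \<alpha> C H a b \<longleftrightarrow>
     \<alpha> \<noteq> 0 \<and> is_convex_cone C \<and>
     0 < a \<and> a \<le> b \<and> H \<subseteq> {a..b} \<and> a \<in> H \<and> b \<in> H \<and>
     {x \<in> C. p \<alpha> x = a} \<noteq> {} \<and> {x \<in> C. p \<alpha> x = b} \<noteq> {}"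

definition lower_value :: "'x set \<Rightarrow> 'y set \<Rightarrow> ('x \<Rightarrow> 'y \<Rightarrow> real) \<Rightarrow> ereal" where
  "lower_value S T u = (SUP x\<in>S. INF y\<in>T. ereal (u x y))"

definition upper_value :: "'x set \<Rightarrow> 'y set \<Rightarrow> ('x \<Rightarrow> 'y \<Rightarrow> real) \<Rightarrow> ereal" where
  "upper_value S T u = (INF y\<in>T. SUP x\<in>S. ereal (u x y))"

definition saddle_point :: "'x set \<Rightarrow> 'y set \<Rightarrow> ('x \<Rightarrow> 'y \<Rightarrow> real) \<Rightarrow> 'x \<Rightarrow> 'y \<Rightarrow> bool" where
  "saddle_point S T u x' y' \<longleftrightarrow>
     x' \<in> S \<and> y' \<in> T \<and> (\<forall>y\<in>T. u x' y \<ge> u x' y') \<and> (\<forall>x\<in>S. u x' y' \<ge> u x y')"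

definition inf_value :: "'a set \<Rightarrow> ('a \<Rightarrow> real) \<Rightarrow> ereal" where
  "inf_value F f = (INF x\<in>F. ereal (f x))"

definition sup_value :: "'a set \<Rightarrow> ('a \<Rightarrow> real) \<Rightarrow> ereal" where
  "sup_value F f = (SUP x\<in>F. ereal (f x))"

definition primal_feasible ::
  "('y::real_vector \<Rightarrow> 'z::real_vector \<Rightarrow> real) \<Rightarrow> ('x \<Rightarrow> 'z) \<Rightarrow> 'z \<Rightarrow> 'x set \<Rightarrow> 'y set \<Rightarrow> 'x set" where
  "primal_feasible pY A \<beta> C K = {x. A x - \<beta> \<in> dual_cone (\<lambda>z y. pY y z) K \<and> x \<in> C}"

definition dual_feasible ::
  "('w::real_vector \<Rightarrow> 'x::real_vector \<Rightarrow> real) \<Rightarrow> ('y \<Rightarrow> 'w) \<Rightarrow> 'w \<Rightarrow> 'x set \<Rightarrow> 'y set \<Rightarrow> 'y set" where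
  "dual_feasible pX A' \<alpha> C K = {y. - A' y + \<alpha> \<in> dual_cone pX C \<and> y \<in> K}"

definition primal_val where
  "primal_val pX pY A \<alpha> \<beta> C K = inf_value (primal_feasible pY A \<beta> C K) (\<lambda>x. pX \<alpha> x)"

definition dual_val where
  "dual_val pX pY A' \<alpha> \<beta> C K = sup_value (dual_feasible pX A' \<alpha> C K) (\<lambda>y. pY y \<beta>)"

definition primal_optimal where
  "primal_optimal pX pY A \<alpha> \<beta> C K x \<longleftrightarrow>
     x \<in> primal_feasible pY A \<beta> C K \<and> ereal (pX \<alpha> x) = primal_val pX pY A \<alpha> \<beta> C K"

definition dual_optimal where
  "dual_optimal pX pY A' \<alpha> \<beta> C K y \<longleftrightarrow>
     y \<in> dual_feasible pX A' \<alpha> C K \<and> ereal (pY y \<beta>) = dual_val pX pY A' \<alpha> \<beta> C K"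

end

theory Submission
  imports Defs
begin

text \<open>
  The two programs are the players' security problems in homogenized form.  If \<open>x\<close> is feasible for
  the primal program and \<open>t \<ge> 0\<close>, then \<open>t x\<close> guarantees player I the payoff \<open>t \<langle>y,\<beta>\<rangle> \<ge> t\<close> against
  every \<open>y \<in> T\<close>; choosing \<open>t = 1 / \<langle>\<alpha>,x\<rangle>\<close> puts \<open>t x\<close> on the level \<open>1 \<in> H\<close>, hence into \<open>S\<close>, and so
  the lower value is at least \<open>1 / \<langle>\<alpha>,x\<rangle>\<close> (\<open>lower_value_ge_inverse\<close>).  Dually, a dual feasible \<open>y\<close>
  with \<open>\<langle>y,\<beta>\<rangle> > 0\<close>, rescaled onto the level \<open>1 \<in> Q\<close>, lies in \<open>T\<close> and holds player I down to
  \<open>1 / \<langle>y,\<beta>\<rangle>\<close> (\<open>upper_value_le_inverse\<close>).  Optimizing over feasible points gives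
  \<open>1 / val(P) \<le> lower value \<le> upper value \<le> 1 / val(D)\<close>, and equality of the optimal values closes
  the chain.  At optimal solutions the same two guarantees, both with \<open>t\<close> equal to the value
  \<open>v = 1 / val(P)\<close> of the game, are the saddle-point inequalities.
\<close>

lemma lower_value_le_upper_value: "lower_value S T u \<le> upper_value S T u"
  unfolding lower_value_def upper_value_def
proof (intro SUP_least INF_greatest)
  fix x y
  assume "x \<in> S" and "y \<in> T"
  have "(INF y\<in>T. ereal (u x y)) \<le> ereal (u x y)"
    using \<open>y \<in> T\<close> by (rule INF_lower)
  also have "\<dots> \<le> (SUP x\<in>S. ereal (u x y))"
    using \<open>x \<in> S\<close> by (rule SUP_upper)
  finally show "(INF y\<in>T. ereal (u x y)) \<le> (SUP x\<in>S. ereal (u x y))" .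
qed

text \<open>The condition \<open>1 \<in> H\<close> is all that rescaling needs: every ray of the cone on which the
  functional is positive meets the level set.\<close>

lemma scale_mem_level_set:
  assumes "bilinear p" and "is_convex_cone C" and "1 \<in> H" and "x \<in> C" and "p \<alpha> x > 0"
  shows "(1 / p \<alpha> x) *\<^sub>R x \<in> level_set p \<alpha> C H"
proof -
  have "(1 / p \<alpha> x) *\<^sub>R x \<in> C"
    using assms by (auto simp: is_convex_cone_def cone_def)
  moreover have "p \<alpha> ((1 / p \<alpha> x) *\<^sub>R x) = 1"
    using assms by (simp add: bilinear_rmul)
  ultimately show ?thesis
    using assms by (simp add: level_set_def)
qed

lemma bilinear_flip: "bilinear p \<Longrightarrow> bilinear (\<lambda>z y. p y z)"
  by (simp add: bilinear_def)

lemma primal_feasible_guarantee: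
  assumes "bilinear pY" and "linear A" and "x \<in> primal_feasible pY A \<beta> C K"
    and "t \<ge> 0" and "y \<in> K" and "1 \<le> pY y \<beta>"
  shows "t \<le> pY y (A (t *\<^sub>R x))"
proof -
  have "0 \<le> pY y (A x - \<beta>)"
    using assms by (auto simp: primal_feasible_def dual_cone_def)
  then have "1 \<le> pY y (A x)"
    using assms by (simp add: bilinear_rsub)
  then have "t * 1 \<le> t * pY y (A x)"
    using assms(4) by (rule mult_left_mono)
  then show ?thesis
    using assms by (simp add: linear_scale bilinear_rmul)
qed

lemma dual_feasible_guarantee:
  assumes "bilinear pX" and "bilinear pY" and "is_adjoint pX pY A A'"
    and "y \<in> dual_feasible pX A' \<alpha> C K"
    and "t \<ge> 0" and "x \<in> C" and "pX \<alpha> x \<le> 1"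
  shows "pY (t *\<^sub>R y) (A x) \<le> t"
proof -
  have "0 \<le> pX (- A' y + \<alpha>) x"
    using assms by (auto simp: dual_feasible_def dual_cone_def)
  then have "pX (A' y) x \<le> pX \<alpha> x"
    using assms by (simp add: bilinear_lsub)
  moreover have "pX (A' y) x = pY y (A x)"
    using assms(3) unfolding is_adjoint_def by blast
  ultimately have "pY y (A x) \<le> 1"
    using assms by simp
  then have "t * pY y (A x) \<le> t * 1"
    using assms(5) by (rule mult_left_mono)
  then show ?thesis
    using assms by (simp add: bilinear_lmul)
qed

lemma lower_value_ge_inverse:
  assumes "bilinear pX" and "bilinear pY" and "linear A"
    and "is_convex_cone C" and "1 \<in> H" and "Q \<subseteq> {1..}"
    and "x \<in> primal_feasible pY A \<beta> C K" and "pX \<alpha> x > 0"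
  shows "ereal (1 / pX \<alpha> x)
    \<le> lower_value (level_set pX \<alpha> C H) (level_set (\<lambda>z y. pY y z) \<beta> K Q) (\<lambda>x y. pY y (A x))"
proof -
  have "(1 / pX \<alpha> x) *\<^sub>R x \<in> level_set pX \<alpha> C H"
    using assms by (intro scale_mem_level_set) (auto simp: primal_feasible_def)
  moreover have "1 / pX \<alpha> x \<le> pY y (A ((1 / pX \<alpha> x) *\<^sub>R x))"
    if "y \<in> level_set (\<lambda>z y. pY y z) \<beta> K Q" for y
    using that assms(6,8)
    by (intro primal_feasible_guarantee[OF assms(2,3,7)]) (auto simp: level_set_def)
  ultimately show ?thesis
    unfolding lower_value_def
    by (blast intro: SUP_upper2 INF_greatest ereal_less_eq(3)[THEN iffD2])
qed

lemma upper_value_le_inverse: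
  assumes "bilinear pX" and "bilinear pY" and "is_adjoint pX pY A A'"
    and "is_convex_cone K" and "1 \<in> Q" and "H \<subseteq> {..1}"
    and "y \<in> dual_feasible pX A' \<alpha> C K" and "pY y \<beta> > 0"
  shows "upper_value (level_set pX \<alpha> C H) (level_set (\<lambda>z y. pY y z) \<beta> K Q) (\<lambda>x y. pY y (A x))
    \<le> ereal (1 / pY y \<beta>)"
proof -
  have "(1 / pY y \<beta>) *\<^sub>R y \<in> level_set (\<lambda>z y. pY y z) \<beta> K Q"
    using assms scale_mem_level_set[OF bilinear_flip[OF assms(2)] assms(4,5), of y \<beta>]
    by (auto simp: dual_feasible_def)
  moreover have "pY ((1 / pY y \<beta>) *\<^sub>R y) (A x) \<le> 1 / pY y \<beta>"
    if "x \<in> level_set pX \<alpha> C H" for x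
    using that assms(6,8)
    by (intro dual_feasible_guarantee[OF assms(1-3,7)]) (auto simp: level_set_def)
  ultimately show ?thesis
    unfolding upper_value_def
    by (blast intro: INF_lower2 SUP_least ereal_less_eq(3)[THEN iffD2])
qed

theorem theorem3p1:
  fixes \<tau>X :: "'x::real_vector topology" and \<tau>W :: "'w::real_vector topology"
    and \<tau>Z :: "'z::real_vector topology" and \<tau>Y :: "'y::real_vector topology"
    and pX :: "'w \<Rightarrow> 'x \<Rightarrow> real" and pY :: "'y \<Rightarrow> 'z \<Rightarrow> real"
    and A :: "'x \<Rightarrow> 'z" and A' :: "'y \<Rightarrow> 'w"
    and \<alpha> :: 'w and \<beta> :: 'z and C S :: "'x set" and K T :: "'y set"
    and H Q :: "real set" and \<gamma> \<delta> :: real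
    and u :: "'x \<Rightarrow> 'y \<Rightarrow> real"
  assumes "locally_convex_tvs \<tau>X" and "locally_convex_tvs \<tau>W"
    and "locally_convex_tvs \<tau>Z" and "locally_convex_tvs \<tau>Y"
    and "dual_pair pX" and "dual_pair pY"
    and "linear A" and "is_adjoint pX pY A A'"
    and "cone_leveled_by pX \<alpha> C H \<gamma> 1"
    and "cone_leveled_by (\<lambda>z y. pY y z) \<beta> K Q 1 \<delta>"
    and "S = level_set pX \<alpha> C H"
    and "T = level_set (\<lambda>z y. pY y z) \<beta> K Q"
    and "u = (\<lambda>x y. pY y (A x))"
    and "\<bar>lower_value S T u\<bar> \<noteq> \<infinity>" and "\<bar>upper_value S T u\<bar> \<noteq> \<infinity>"
    and "lower_value S T u > 0"
    and "primal_feasible pY A \<beta> C K \<noteq> {}" and "dual_feasible pX A' \<alpha> C K \<noteq> {}"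
    and "primal_val pX pY A \<alpha> \<beta> C K = dual_val pX pY A' \<alpha> \<beta> C K"
    and "primal_val pX pY A \<alpha> \<beta> C K > 0"
  shows "\<exists>v::real.
           lower_value S T u = ereal v \<and> upper_value S T u = ereal v \<and>
           ereal v = 1 / primal_val pX pY A \<alpha> \<beta> C K \<and>
           (\<forall>x y. primal_optimal pX pY A \<alpha> \<beta> C K x \<longrightarrow> dual_optimal pX pY A' \<alpha> \<beta> C K y \<longrightarrow>
                  saddle_point S T u (v *\<^sub>R x) (v *\<^sub>R y))"
proof -
  have bX: "bilinear pX" and bY: "bilinear pY"
    using assms(5,6) by (auto simp: dual_pair_def)
  have C: "is_convex_cone C" "1 \<in> H" "H \<subseteq> {..1}"
    using assms(9) by (auto simp: cone_leveled_by_def)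
  have K: "is_convex_cone K" "1 \<in> Q" "Q \<subseteq> {1..}"
    using assms(10) by (auto simp: cone_leveled_by_def)
  let ?P = "primal_val pX pY A \<alpha> \<beta> C K"
  obtain x0 where "x0 \<in> primal_feasible pY A \<beta> C K"
    using assms(17) by auto
  then have "?P \<le> ereal (pX \<alpha> x0)"
    unfolding primal_val_def inf_value_def by (rule INF_lower)
  then obtain P where P: "?P = ereal P" and "P > 0"
    using assms(20) by (cases ?P) auto
  obtain l where l: "lower_value S T u = ereal l" and "l > 0"
    using assms(14,16) by (cases "lower_value S T u") auto
  obtain m where m: "upper_value S T u = ereal m"
    using assms(15) by (cases "upper_value S T u") auto
  have "l \<le> m"
    using lower_value_le_upper_value[of S T u] l m by simp

  \<comment> \<open>Player I's guarantees: every feasible cost is at least \<open>1 / l\<close>, so the infimum is.\<close>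
  have "1 / l \<le> pX \<alpha> x" if x: "x \<in> primal_feasible pY A \<beta> C K" for x
  proof -
    have "?P \<le> ereal (pX \<alpha> x)"
      unfolding primal_val_def inf_value_def using x by (rule INF_lower)
    then have pos: "pX \<alpha> x > 0"
      using P \<open>P > 0\<close> by simp
    then have "1 / pX \<alpha> x \<le> l"
      using lower_value_ge_inverse[OF bX bY assms(7) C(1,2) K(3) x pos] l assms(11-13) by simp
    then show ?thesis
      using pos \<open>l > 0\<close> by (simp add: field_simps)
  qed
  then have "ereal (1 / l) \<le> ?P"
    unfolding primal_val_def inf_value_def by (intro INF_greatest) auto
  then have "1 / P \<le> l"
    using P \<open>P > 0\<close> \<open>l > 0\<close> by (simp add: field_simps)
  moreover
  \<comment> \<open>Player II's guarantees: every feasible dual objective is at most \<open>1 / m\<close>, trivially so if it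
    is not positive.\<close>
  have "pY y \<beta> \<le> 1 / m" if y: "y \<in> dual_feasible pX A' \<alpha> C K" for y
  proof (cases "pY y \<beta> > 0")
    case True
    then have "m \<le> 1 / pY y \<beta>"
      using upper_value_le_inverse[OF bX bY assms(8) K(1,2) C(3) y True] m assms(11-13) by simp
    then show ?thesis
      using True \<open>l > 0\<close> \<open>l \<le> m\<close> by (simp add: field_simps)
  next
    case False
    moreover have "0 \<le> 1 / m"
      using \<open>l > 0\<close> \<open>l \<le> m\<close> by simp
    ultimately show ?thesis
      by linarith
  qed
  then have "?P \<le> ereal (1 / m)"
    unfolding assms(19) dual_val_def sup_value_def by (intro SUP_least) auto
  then have "m \<le> 1 / P"
    using P \<open>P > 0\<close> \<open>l > 0\<close> \<open>l \<le> m\<close> by (simp add: field_simps)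
  ultimately have v: "l = 1 / P" "m = 1 / P"
    using \<open>l \<le> m\<close> by auto

  have "saddle_point S T u ((1 / P) *\<^sub>R x) ((1 / P) *\<^sub>R y)"
    if optx: "primal_optimal pX pY A \<alpha> \<beta> C K x" and opty: "dual_optimal pX pY A' \<alpha> \<beta> C K y"
    for x y
  proof -
    have fx: "x \<in> primal_feasible pY A \<beta> C K" and vx: "pX \<alpha> x = P"
      using optx P by (auto simp: primal_optimal_def)
    have fy: "y \<in> dual_feasible pX A' \<alpha> C K" and vy: "pY y \<beta> = P"
      using opty P assms(19) by (auto simp: dual_optimal_def)
    have xS: "(1 / P) *\<^sub>R x \<in> S"
      using scale_mem_level_set[OF bX C(1,2), of x \<alpha>] fx vx \<open>P > 0\<close> assms(11)
      by (simp add: primal_feasible_def)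
    have yT: "(1 / P) *\<^sub>R y \<in> T"
      using scale_mem_level_set[OF bilinear_flip[OF bY] K(1,2), of y \<beta>] fy vy \<open>P > 0\<close> assms(12)
      by (simp add: dual_feasible_def)
    have lo: "1 / P \<le> u ((1 / P) *\<^sub>R x) y'" if "y' \<in> T" for y'
      using primal_feasible_guarantee[OF bY assms(7) fx] that K(3) \<open>P > 0\<close> assms(12,13)
      by (auto simp: level_set_def)
    have up: "u x' ((1 / P) *\<^sub>R y) \<le> 1 / P" if "x' \<in> S" for x'
      using dual_feasible_guarantee[OF bX bY assms(8) fy] that C(3) \<open>P > 0\<close> assms(11,13)
      by (auto simp: level_set_def)
    have "u ((1 / P) *\<^sub>R x) ((1 / P) *\<^sub>R y) = 1 / P"
      using lo[OF yT] up[OF xS] by simp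
    then show ?thesis
      using xS yT lo up by (simp add: saddle_point_def)
  qed
  moreover have "ereal (1 / P) = 1 / ?P"
    using P \<open>P > 0\<close> by (simp add: one_ereal_def)
  ultimately show ?thesis
    using l m v by (intro exI[of _ "1 / P"]) auto
qed

end
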